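(* Let $t_1,t_3,t_4,m_1\in\mathbb{R}$ and let $\mathfrak g$ be the real linear span of $E_1=\begin{pmatrix} t_1&t_3+it_4&-\frac{i}{2}(t_1m_1+t_4^2+t_3^2)&1\\2t_3-2it_4&0&im_1(-t_3+it_4)&0\\4i&0&2m_1&0\\0&0&0&0\end{pmatrix}$, $E_2=\begin{pmatrix}0&t_4-it_3&\frac12(t_3^2+t_4^2)&i\\0&0&0&0\\0&0&0&0\\0&0&0&0\end{pmatrix}$, $E_3=\begin{pmatrix}t_3-it_4&-m_1&\frac{i}{2}m_1(-t_3+it_4)&0\\0&-2it_4&\frac{i}{2}(-t_3+it_4)(t_3+it_4)&1\\0&2i&0&0\\0&0&0&0\end{pmatrix}$, $E_4=\begin{pmatrix}-t_4-it_3&im_1&\frac12 m_1(-t_3+it_4)&0\\0&-2it_3&\frac12(t_3^2+t_4^2)&i\\0&2&0&0\\0&0&0&0\end{pmatrix}$, $E_5=\begin{pmatrix}-\frac{i}{2}(t_3^2+t_4^2)&\frac{i}{2}m_1(t_3+it_4)&-\frac14 m_1(t_3^2+t_4^2)&0\\0&-\frac{i}{2}(t_3^2+t_4^2)&0&0\\0&0&-\frac{i}{2}(t_3^2+t_4^2)&1\\0&0&0&0\end{pmatrix}$. Then every integral variety of type $(1/2,0)$ related to $\mathfrak g$ is affinely equivalent to (an open piece of) one of the hypersurfaces 1) $v=2x_1^2+|z_2|^2$; 2) $v=-\ln(1+x_1)+|z_2|^2$; 3) $\mathrm{Re}(\bar z_1 w)=(\mathrm{Re}(z_1\bar z_2))^{\alpha}$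 for some $\alpha\in(-\infty,0)$.
   Context: Coordinates in $\mathbb{C}^3$ are $z_1=x_1+iy_1$, $z_2=x_2+iy_2$, $w=u+iv$, $z=(z_1,z_2)$. To a complex $4\times4$ matrix $\begin{pmatrix}a_1&a_2&a_3&p\\ b_1&b_2&b_3&s\\ c_1&c_2&c_3&q\\0&0&0&0\end{pmatrix}$ one associates the holomorphic affine vector field $Z=(a_1z_1+a_2z_2+a_3w+p)\frac{\partial}{\partial z_1}+(b_1z_1+b_2z_2+b_3w+s)\frac{\partial}{\partial z_2}+(c_1z_1+c_2z_2+c_3w+q)\frac{\partial}{\partial w}$. For a real linear span $\mathfrak g$ of such matrices, an integral variety of type $(1/2,0)$ related to $\mathfrak g$ is a real-analytic strictly pseudoconvex real hypersurface $M$ defined near $0\in\mathbb{C}^3$, with $0\in M$, given near $0$ by an equation $v=|z_1|^2+|z_2|^2+\frac12(z_1^2+\bar z_1^2)+\sum_{k+l+2m\ge 3}F_{klm}(z,\bar z)u^m$ (with $F_{klm}$ a polynomial of degree $k$ in $z$ and $l$ in $\bar z$, the right-hand side real), such that for every $Z\in\mathfrak g$ the real vector field $Z+\bar Z$ is tangent to $M$, i.e. $\mathrm{Re}(Z(\Phi))|_M=0$ for a defining function $\Phi$ of $M$. Two hypersurfaces are affinely equivalent if a complex affine transformation of $\mathbb{C}^3$ maps a neighbourhood in one onto an open piece of the other. *)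

theory Defs
  imports "HOL-Analysis.Analysis"
begin

text \<open>Points of C^3 are vectors p :: complex^3 with p$1 = z1, p$2 = z2, p$3 = w.
  Complex 4x4 matrices are functions nat => nat => complex, indices 0..3.\<close>

definition affine_field :: "(nat \<Rightarrow> nat \<Rightarrow> complex) \<Rightarrow> complex^3 \<Rightarrow> complex^3" where
  "affine_field A p = (\<chi> i. let r = (if i = 1 then 0 else if i = 2 then 1 else 2) in
      A r 0 * p$1 + A r 1 * p$2 + A r 2 * p$3 + A r 3)"

definition mat_of_rows :: "complex list list \<Rightarrow> nat \<Rightarrow> nat \<Rightarrow> complex" where
  "mat_of_rows rs i j = rs ! i ! j"

definition E1 :: "real \<Rightarrow> real \<Rightarrow> real \<Rightarrow> real \<Rightarrow> nat \<Rightarrow> nat \<Rightarrow> complex" where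
  "E1 t1 t3 t4 m1 = (let T1 = complex_of_real t1; T3 = complex_of_real t3;
      T4 = complex_of_real t4; M1 = complex_of_real m1 in mat_of_rows
   [[T1, T3 + \<i>*T4, -(\<i>/2)*(T1*M1 + T4^2 + T3^2), 1],
    [2*T3 - 2*\<i>*T4, 0, \<i>*M1*(-T3 + \<i>*T4), 0],
    [4*\<i>, 0, 2*M1, 0],
    [0, 0, 0, 0]])"

definition E2 :: "real \<Rightarrow> real \<Rightarrow> real \<Rightarrow> real \<Rightarrow> nat \<Rightarrow> nat \<Rightarrow> complex" where
  "E2 t1 t3 t4 m1 = (let T3 = complex_of_real t3; T4 = complex_of_real t4 in mat_of_rows
   [[0, T4 - \<i>*T3, (1/2)*(T3^2 + T4^2), \<i>],
    [0, 0, 0, 0],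
    [0, 0, 0, 0],
    [0, 0, 0, 0]])"

definition E3 :: "real \<Rightarrow> real \<Rightarrow> real \<Rightarrow> real \<Rightarrow> nat \<Rightarrow> nat \<Rightarrow> complex" where
  "E3 t1 t3 t4 m1 = (let T3 = complex_of_real t3;
      T4 = complex_of_real t4; M1 = complex_of_real m1 in mat_of_rows
   [[T3 - \<i>*T4, -M1, (\<i>/2)*M1*(-T3 + \<i>*T4), 0],
    [0, -2*\<i>*T4, (\<i>/2)*(-T3 + \<i>*T4)*(T3 + \<i>*T4), 1],
    [0, 2*\<i>, 0, 0],
    [0, 0, 0, 0]])"

definition E4 :: "real \<Rightarrow> real \<Rightarrow> real \<Rightarrow> real \<Rightarrow> nat \<Rightarrow> nat \<Rightarrow> complex" where
  "E4 t1 t3 t4 m1 = (let T3 = complex_of_real t3;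
      T4 = complex_of_real t4; M1 = complex_of_real m1 in mat_of_rows
   [[-T4 - \<i>*T3, \<i>*M1, (1/2)*M1*(-T3 + \<i>*T4), 0],
    [0, -2*\<i>*T3, (1/2)*(T3^2 + T4^2), \<i>],
    [0, 2, 0, 0],
    [0, 0, 0, 0]])"

definition E5 :: "real \<Rightarrow> real \<Rightarrow> real \<Rightarrow> real \<Rightarrow> nat \<Rightarrow> nat \<Rightarrow> complex" where
  "E5 t1 t3 t4 m1 = (let T3 = complex_of_real t3;
      T4 = complex_of_real t4; M1 = complex_of_real m1 in mat_of_rows
   [[-(\<i>/2)*(T3^2 + T4^2), (\<i>/2)*M1*(T3 + \<i>*T4), -(1/4)*M1*(T3^2 + T4^2), 0],
    [0, -(\<i>/2)*(T3^2 + T4^2), 0, 0],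
    [0, 0, -(\<i>/2)*(T3^2 + T4^2), 1],
    [0, 0, 0, 0]])"

definition g_alg :: "real \<Rightarrow> real \<Rightarrow> real \<Rightarrow> real \<Rightarrow> (nat \<Rightarrow> nat \<Rightarrow> complex) set" where
  "g_alg t1 t3 t4 m1 = {(\<lambda>i j. complex_of_real a1 * E1 t1 t3 t4 m1 i j
        + complex_of_real a2 * E2 t1 t3 t4 m1 i j + complex_of_real a3 * E3 t1 t3 t4 m1 i j
        + complex_of_real a4 * E4 t1 t3 t4 m1 i j + complex_of_real a5 * E5 t1 t3 t4 m1 i j)
      | a1 a2 a3 a4 a5. True}"

definition coords :: "complex^3 \<Rightarrow> real \<times> real \<times> real \<times> real \<times> real" where
  "coords p = (Re (p$1), Im (p$1), Re (p$2), Im (p$2), Re (p$3))"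

text \<open>Real monomial x1^a y1^b x2^c y2^d u^e and its weight a+b+c+d+2e
  (u has weight 2, as in the expansion with k+l+2m).\<close>
fun monom :: "nat \<times> nat \<times> nat \<times> nat \<times> nat \<Rightarrow> real \<times> real \<times> real \<times> real \<times> real \<Rightarrow> real" where
  "monom (a, b, c, d, e) (x1, y1, x2, y2, u) = x1^a * y1^b * x2^c * y2^d * u^e"

fun weight :: "nat \<times> nat \<times> nat \<times> nat \<times> nat \<Rightarrow> nat" where
  "weight (a, b, c, d, e) = a + b + c + d + 2*e"

text \<open>Normal form: the terms of weight <= 2 are exactly
  |z1|^2 + |z2|^2 + (z1^2 + conj z1^2)/2 = 2 x1^2 + x2^2 + y2^2.\<close>
definition normal_coeffs :: "(nat \<times> nat \<times> nat \<times> nat \<times> nat \<Rightarrow> real) \<Rightarrow> bool" where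
  "normal_coeffs c \<longleftrightarrow> (\<forall>\<alpha>. weight \<alpha> \<le> 2 \<longrightarrow>
      c \<alpha> = (if \<alpha> = (2,0,0,0,0) then 2 else if \<alpha> = (0,0,2,0,0) then 1
               else if \<alpha> = (0,0,0,2,0) then 1 else 0))"

text \<open>Integral variety of type (1/2,0) related to g: M = {v = F(x1,y1,x2,y2,u)} inside
  an open neighbourhood U of 0, F a real power series (real-analytic) converging on U
  in the normal form, and Z + conj Z tangent to M for all Z in g.\<close>
definition integral_variety :: "(nat \<Rightarrow> nat \<Rightarrow> complex) set \<Rightarrow> (complex^3) set \<Rightarrow> bool" where
  "integral_variety g M \<longleftrightarrow>
     (\<exists>U c F. open U \<and> 0 \<in> U \<and> normal_coeffs c \<and>
        (\<forall>p\<in>U. ((\<lambda>\<alpha>. c \<alpha> * monom \<alpha> (coords p)) has_sum F (coords p)) UNIV) \<and>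
        M = {p \<in> U. Im (p$3) = F (coords p)} \<and>
        (\<forall>p\<in>M. \<forall>A\<in>g. \<exists>D. ((\<lambda>q. F (coords q) - Im (q$3)) has_derivative D) (at p)
                             \<and> D (affine_field A p) = 0))"

definition aff_equiv :: "(complex^3) set \<Rightarrow> (complex^3) set \<Rightarrow> bool" where
  "aff_equiv M S \<longleftrightarrow> (\<exists>(L::complex^3^3) b V W. invertible L \<and> open V \<and> 0 \<in> V \<and> open W \<and>
      (\<lambda>p. L *v p + b) ` (M \<inter> V) = S \<inter> W)"

definition model1 :: "(complex^3) set" where
  "model1 = {p. Im (p$3) = 2 * (Re (p$1))^2 + (cmod (p$2))^2}"

definition model2 :: "(complex^3) set" where
  "model2 = {p. 1 + Re (p$1) > 0 \<and> Im (p$3) = - ln (1 + Re (p$1)) + (cmod (p$2))^2}"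

definition model3 :: "real \<Rightarrow> (complex^3) set" where
  "model3 \<alpha> = {p. Re (p$1 * cnj (p$2)) > 0 \<and>
      Re (cnj (p$1) * p$3) = Re (p$1 * cnj (p$2)) powr \<alpha>}"

end

theory Submission
  imports Defs
begin

text \<open>
  The five generators take the real values \<open>\<partial>/\<partial>x1\<close>, \<open>\<partial>/\<partial>y1\<close>, \<open>\<partial>/\<partial>x2\<close>, \<open>\<partial>/\<partial>y2\<close>, \<open>\<partial>/\<partial>u\<close> at the
  origin, so near \<open>0\<close> they span the tangent space of \<open>M\<close>. Hence any function \<open>r\<close> near \<open>0\<close> that
  vanishes at \<open>0\<close>, is annihilated by the generators and has \<open>\<partial>r/\<partial>v \<noteq> 0\<close> is constant on \<open>M\<close>, and
  \<open>M\<close> is the zero set of \<open>r\<close> near \<open>0\<close>. It remains to exhibit such a first integral, always the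
  equation of a model composed with an affine map.

  If \<open>t3 = t4 = 0\<close>, put \<open>z = z1 - (i m1/2) w\<close> and \<open>\<lambda> = t1 + 2 m1\<close>. The generators become
  translations in \<open>Im z\<close>, \<open>w\<close>, Heisenberg translations in \<open>(z2, w)\<close> and \<open>z' = \<lambda> z + 1, w' = 4 i z\<close>,
  which gives model 1 for \<open>\<lambda> = 0\<close> and model 2 otherwise.

  If \<open>\<tau> = t3 + i t4 \<noteq> 0\<close>, the generators have a common zero, and centred there they are linear.
  The linear forms that are eigenvectors of \<open>E1\<close> have eigenvalue \<open>0\<close> or one of the roots
  \<open>lm < 0 < lp\<close> of \<open>l\<^sup>2 = (t1 + 2 m1) l + 4 |\<tau>|\<^sup>2\<close>; normalised to \<open>1\<close> at the origin they are the
  coordinates of model 3, with \<open>\<alpha> = lm / lp\<close>.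
\<close>

section \<open>Affine fields and the frame they form at the origin\<close>

lemma affine_field_nth [simp]:
  "affine_field A p $ 1 = A 0 0 * p$1 + A 0 1 * p$2 + A 0 2 * p$3 + A 0 3"
  "affine_field A p $ 2 = A 1 0 * p$1 + A 1 1 * p$2 + A 1 2 * p$3 + A 1 3"
  "affine_field A p $ 3 = A 2 0 * p$1 + A 2 1 * p$2 + A 2 2 * p$3 + A 2 3"
  by (auto simp: affine_field_def)

lemma continuous_affine_field: "continuous_on S (affine_field A)"
  unfolding affine_field_def Let_def
  by (intro continuous_on_vec_lambda continuous_intros)

text \<open>Quantitative form of: a frame that is a basis at the origin is a basis nearby.\<close>

lemma linear_functional_zero_if_near_basis:
  fixes T :: "'a::euclidean_space \<Rightarrow> real"
  assumes T: "linear T" and small: "e * real DIM('a) < 1"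
    and near: "\<And>b. b \<in> Basis \<Longrightarrow> \<exists>z. T z = 0 \<and> norm (z - b) \<le> e"
  shows "T h = 0"
proof -
  have bl: "bounded_linear T" using T by (simp add: linear_linear)
  have b: "\<bar>T b\<bar> \<le> onorm T * e" if "b \<in> Basis" for b
  proof -
    from near[OF that] obtain z where z: "T z = 0" "norm (z - b) \<le> e" by blast
    have "\<bar>T b\<bar> = \<bar>T (z - b)\<bar>" using z T by (simp add: linear_diff)
    also have "\<dots> \<le> onorm T * norm (z - b)" using onorm[OF bl, of "z - b"] by simp
    also have "\<dots> \<le> onorm T * e" using z onorm_pos_le[OF bl] by (intro mult_left_mono) auto
    finally show ?thesis .
  qed
  \<comment> \<open>Expanding \<open>h\<close> in the basis bounds the operator norm by
    \<open>e * DIM('a) < 1\<close> times itself, so it must be \<open>0\<close>.\<close>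
  have "norm (T h) \<le> (onorm T * e * DIM('a)) * norm h" for h
  proof -
    have "T h = T (\<Sum>b\<in>Basis. (h \<bullet> b) *\<^sub>R b)" by (simp add: euclidean_representation)
    also have "\<dots> = (\<Sum>b\<in>Basis. (h \<bullet> b) * T b)"
      using T by (simp add: linear_sum linear_scale)
    finally have "norm (T h) \<le> (\<Sum>b\<in>Basis. \<bar>h \<bullet> b\<bar> * \<bar>T b\<bar>)"
      by (simp add: sum_abs abs_mult[symmetric])
    also have "\<dots> \<le> (\<Sum>b\<in>(Basis::'a set). norm h * (onorm T * e))"
      by (intro sum_mono mult_mono b Basis_le_norm) auto
    finally show ?thesis by (simp add: mult_ac)
  qed
  hence le: "onorm T \<le> onorm T * (e * DIM('a))"
    by (metis onorm_le mult.assoc)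
  have "onorm T = 0"
  proof (rule ccontr)
    assume "onorm T \<noteq> 0"
    hence "onorm T > 0" using onorm_pos_le[OF bl] by simp
    hence "onorm T * (e * DIM('a)) < onorm T * 1"
      using small by (intro mult_strict_left_mono) auto
    with le show False by simp
  qed
  thus ?thesis using onorm_eq_0[OF bl] by blast
qed

lemma Basis_vec3: "b \<in> (Basis :: (complex^3) set) \<Longrightarrow>
    b \<in> {axis 1 1, axis 1 \<i>, axis 2 1, axis 2 \<i>, axis 3 1, axis 3 \<i>}"
  by (auto simp: Basis_vec_def Basis_complex_def) (metis exhaust_3)+

lemma E_at_0:
  "affine_field (E1 t1 t3 t4 m1) 0 = axis 1 1"
  "affine_field (E2 t1 t3 t4 m1) 0 = axis 1 \<i>"
  "affine_field (E3 t1 t3 t4 m1) 0 = axis 2 1"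
  "affine_field (E4 t1 t3 t4 m1) 0 = axis 2 \<i>"
  "affine_field (E5 t1 t3 t4 m1) 0 = axis 3 1"
  by (simp_all add: vec_eq_iff forall_3 axis_def
      E1_def E2_def E3_def E4_def E5_def mat_of_rows_def Let_def)

abbreviation gens :: "real \<Rightarrow> real \<Rightarrow> real \<Rightarrow> real \<Rightarrow> (nat \<Rightarrow> nat \<Rightarrow> complex) set" where
  "gens t1 t3 t4 m1 \<equiv>
    {E1 t1 t3 t4 m1, E2 t1 t3 t4 m1, E3 t1 t3 t4 m1, E4 t1 t3 t4 m1, E5 t1 t3 t4 m1}"

text \<open>Of the six real directions only that of \<open>v\<close> is missing from the generators
  at the origin; it is the direction transversal to the graph \<open>M\<close>.\<close>

lemma Basis_gens:
  fixes b :: "complex^3"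
  assumes "b \<in> Basis"
  shows "b = axis 3 \<i> \<or> (\<exists>A\<in>gens t1 t3 t4 m1. affine_field A 0 = b)"
  using Basis_vec3[OF assms] by (auto simp: E_at_0)

lemma gens_subset_g_alg: "gens t1 t3 t4 m1 \<subseteq> g_alg t1 t3 t4 m1"
proof -
  have *: "(\<lambda>i j. complex_of_real a1 * E1 t1 t3 t4 m1 i j
        + complex_of_real a2 * E2 t1 t3 t4 m1 i j + complex_of_real a3 * E3 t1 t3 t4 m1 i j
        + complex_of_real a4 * E4 t1 t3 t4 m1 i j + complex_of_real a5 * E5 t1 t3 t4 m1 i j)
      \<in> g_alg t1 t3 t4 m1" for a1 a2 a3 a4 a5
    unfolding g_alg_def by blast
  show ?thesis
    using *[of 1 0 0 0 0] *[of 0 1 0 0 0] *[of 0 0 1 0 0] *[of 0 0 0 1 0] *[of 0 0 0 0 1]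
    by simp
qed

section \<open>Hypersurfaces determined by a first integral\<close>

text \<open>On \<open>M\<close> the differentials of \<open>r\<close> and of the defining function
  \<open>F - v\<close> both annihilate the generators, hence are proportional near \<open>0\<close>,
  so \<open>r\<close> is constant along \<open>M\<close>. Conversely \<open>r\<close> is strictly
  monotone in \<open>v\<close> near \<open>0\<close>, so a vertical segment contains at most one
  zero of \<open>r\<close>.\<close>

lemma first_integral_zero_set:
  fixes r :: "complex^3 \<Rightarrow> real" and r' :: "complex^3 \<Rightarrow> complex^3 \<Rightarrow> real"
  assumes M: "integral_variety (g_alg t1 t3 t4 m1) M"
    and N: "open N" "0 \<in> N"
    and der: "\<And>p. p \<in> N \<Longrightarrow> (r has_derivative r' p) (at p)"
    and tangent: "\<And>p A. p \<in> N \<Longrightarrow> A \<in> gens t1 t3 t4 m1 \<Longrightarrow> r' p (affine_field A p) = 0"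
    and cont: "isCont (\<lambda>p. r' p (axis 3 \<i>)) 0"
    and nz: "r' 0 (axis 3 \<i>) \<noteq> 0"
    and r0: "r 0 = 0"
  shows "\<exists>V. open V \<and> 0 \<in> V \<and> V \<subseteq> N \<and> M \<inter> V = {p \<in> V. r p = 0}"
proof -
  define e where "e = (axis 3 \<i> :: complex^3)"
  have e_nth: "e $ 1 = 0" "e $ 2 = 0" "e $ 3 = \<i>" by (auto simp: e_def axis_def)
  obtain U c F where UcF: "open U \<and> 0 \<in> U \<and> normal_coeffs c \<and>
        (\<forall>p\<in>U. ((\<lambda>\<alpha>. c \<alpha> * monom \<alpha> (coords p)) has_sum F (coords p)) UNIV) \<and>
        M = {p \<in> U. Im (p$3) = F (coords p)} \<and>
        (\<forall>p\<in>M. \<forall>A\<in>g_alg t1 t3 t4 m1. \<exists>D. ((\<lambda>q. F (coords q) - Im (q$3)) has_derivative D) (at p)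
                             \<and> D (affine_field A p) = 0)"
    using M unfolding integral_variety_def by (elim exE) (rule that)
  then have U: "open U" "0 \<in> U" and c: "normal_coeffs c"
    and Meq: "M = {p \<in> U. Im (p$3) = F (coords p)}"
    by (simp_all only:)
  have sums: "((\<lambda>\<alpha>. c \<alpha> * monom \<alpha> (coords p)) has_sum F (coords p)) UNIV" if "p \<in> U" for p
    using UcF that by (simp only:)
  have tanM: "\<exists>D. ((\<lambda>q. F (coords q) - Im (q$3)) has_derivative D) (at p) \<and> D (affine_field A p) = 0"
    if "p \<in> M" "A \<in> g_alg t1 t3 t4 m1" for p A
    using conjunct2[OF conjunct2[OF conjunct2[OF conjunct2[OF conjunct2[OF UcF]]]]] that by blast
  define G where "G q = F (coords q) - Im (q$3)" for q :: "complex^3"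
  have coords_e: "coords (q + s *\<^sub>R e) = coords q" for q s
    by (simp add: coords_def e_nth)
  have G_e: "G (q + s *\<^sub>R e) = G q - s" for q s
    by (simp add: G_def coords_e e_nth)
  have "F (coords 0) = 0"
  \<comment> \<open>The constant coefficient is \<open>0\<close> by the normal form, and every other
    monomial vanishes at the origin.\<close>
  proof -
    have "c \<alpha> * monom \<alpha> (coords 0) = 0" for \<alpha>
    proof (cases "\<alpha> = (0,0,0,0,0)")
      case True
      thus ?thesis using c by (simp add: normal_coeffs_def)
    next
      case False
      thus ?thesis by (cases \<alpha>) (auto simp: coords_def power_0_left)
    qed
    hence "((\<lambda>\<alpha>::nat \<times> nat \<times> nat \<times> nat \<times> nat. 0) has_sum F (coords (0::complex^3))) UNIV"
      using sums[OF U(2)] by (simp only:)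
    thus ?thesis by (rule has_sum_unique) (simp add: has_sum_0)
  qed
  hence G0: "G 0 = 0" and M0: "0 \<in> M" using U by (auto simp: G_def Meq)

  \<comment> \<open>The projection onto \<open>M\<close> along the \<open>v\<close>-axis, as long as the image stays in \<open>U\<close>.\<close>
  define \<phi> where "\<phi> q = q + G q *\<^sub>R e" for q
  have \<phi>0: "\<phi> 0 = 0" by (simp add: \<phi>_def G0)
  have \<phi>M: "\<phi> q \<in> M" if "\<phi> q \<in> U" for q
    using that by (simp add: Meq \<phi>_def coords_e e_nth G_def)
  \<comment> \<open>Tangency supplies a derivative for each field separately; uniqueness of the
    derivative makes it the same for all generators.\<close>
  have "\<exists>D. (G has_derivative D) (at p) \<and> (\<forall>A\<in>gens t1 t3 t4 m1. D (affine_field A p) = 0)"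
    if p: "p \<in> M" for p
  proof -
    have tan: "\<exists>D. (G has_derivative D) (at p) \<and> D (affine_field A p) = 0"
      if "A \<in> gens t1 t3 t4 m1" for A
      unfolding G_def[abs_def] using tanM[OF p] that gens_subset_g_alg by blast
    then obtain D where D: "(G has_derivative D) (at p)" by blast
    have "D (affine_field A p) = 0" if "A \<in> gens t1 t3 t4 m1" for A
    proof -
      from tan[OF that] obtain D1 where "(G has_derivative D1) (at p)" "D1 (affine_field A p) = 0"
        by blast
      with has_derivative_unique[OF D] show ?thesis by simp
    qed
    with D show ?thesis by blast
  qed
  then obtain D where D: "\<And>p. p \<in> M \<Longrightarrow> (G has_derivative D p) (at p)"
    and DA: "\<And>p A. p \<in> M \<Longrightarrow> A \<in> gens t1 t3 t4 m1 \<Longrightarrow> D p (affine_field A p) = 0"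
    by metis
  \<comment> \<open>Differentiability is given only at points of \<open>M\<close>. Since a vertical
    shift changes \<open>G\<close> by a constant, the derivative at \<open>\<phi> q\<close> is also
    the derivative at \<open>q\<close>.\<close>
  have D\<phi>: "(G has_derivative D (\<phi> q)) (at q)" if "\<phi> q \<in> U" for q
  proof -
    have "((\<lambda>x. G (x + G q *\<^sub>R e) + G q) has_derivative (\<lambda>h. D (\<phi> q) h)) (at q)"
      using D[OF \<phi>M[OF that]] unfolding \<phi>_def
      by (auto intro!: derivative_eq_intros has_derivative_compose[of "\<lambda>x. x + G q *\<^sub>R e" "\<lambda>h. h" q UNIV G])
    thus ?thesis by (simp add: G_e)
  qed
  have De: "D (\<phi> q) e = -1" if "\<phi> q \<in> U" for q
  proof -
    have "((\<lambda>s. G (q + s *\<^sub>R e)) has_derivative (\<lambda>s. D (\<phi> q) (s *\<^sub>R e))) (at 0)"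
      by (rule has_derivative_compose[of "\<lambda>s. q + s *\<^sub>R e" "\<lambda>s. s *\<^sub>R e" 0 UNIV G])
         (auto intro!: derivative_eq_intros D\<phi>[OF that])
    moreover have "((\<lambda>s. G (q + s *\<^sub>R e)) has_derivative (\<lambda>s. - s)) (at 0)"
      unfolding G_e by (auto intro!: derivative_eq_intros)
    ultimately have "(\<lambda>s. D (\<phi> q) (s *\<^sub>R e)) = (\<lambda>s. - s)"
      by (rule has_derivative_unique)
    from fun_cong[OF this, of 1] show ?thesis by simp
  qed

  \<comment> \<open>The bound \<open>1/7\<close> suits the real dimension 6 of the space:
    \<open>6/7 < 1\<close>.\<close>
  have near: "\<forall>\<^sub>F p in nhds 0. norm (affine_field A p - affine_field A 0) \<le> 1/7" for A
  proof -
    have "isCont (affine_field A) 0"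
      using continuous_affine_field[of UNIV A] by (simp add: continuous_on_eq_continuous_at)
    hence "(affine_field A \<longlongrightarrow> affine_field A 0) (nhds 0)"
      by (simp add: isCont_def tendsto_at_iff_tendsto_nhds)
    from tendstoD[OF this, of "1/7"] show ?thesis
      by (auto elim!: eventually_mono simp: dist_norm)
  qed
  \<comment> \<open>A positive product says that \<open>r' p e\<close> keeps the sign of
    \<open>r' 0 e\<close>.\<close>
  have nze: "\<forall>\<^sub>F p in nhds 0. r' p e * r' 0 e > 0"
  proof -
    have "((\<lambda>p. r' p e * r' 0 e) \<longlongrightarrow> r' 0 e * r' 0 e) (nhds 0)"
      using cont tendsto_at_iff_tendsto_nhds[of "\<lambda>p. r' p e" 0]
      by (intro tendsto_intros) (simp add: isCont_def e_def)
    moreover have "r' 0 e * r' 0 e > 0" using nz by (simp add: e_def zero_less_mult_iff neq_iff disj_commute)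
    ultimately show ?thesis by (rule order_tendstoD)
  qed
  have "\<forall>\<^sub>F p in nhds 0. p \<in> U \<and> p \<in> N \<and> r' p e * r' 0 e > 0 \<and>
      (\<forall>A\<in>gens t1 t3 t4 m1. norm (affine_field A p - affine_field A 0) \<le> 1/7)"
    using near nze U N
    by (auto simp: eventually_conj_iff eventually_nhds_in_open)
  then obtain d where d: "d > 0" and good: "\<And>p. p \<in> ball 0 d \<Longrightarrow> p \<in> U \<and> p \<in> N \<and> r' p e * r' 0 e > 0 \<and>
      (\<forall>A\<in>gens t1 t3 t4 m1. norm (affine_field A p - affine_field A 0) \<le> 1/7)"
    by (auto simp: eventually_nhds_metric dist_commute)
  have "isCont G 0" using D[OF M0] has_derivative_continuous by blast
  hence "isCont \<phi> 0" unfolding \<phi>_def by (intro continuous_intros)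
  then obtain d1 where d1: "d1 > 0" and \<phi>ball: "\<And>q. q \<in> ball 0 d1 \<Longrightarrow> \<phi> q \<in> ball 0 d"
    using d unfolding continuous_at_eps_delta \<phi>0 by (metis dist_commute mem_ball)

  \<comment> \<open>This functional annihilates the generators at \<open>p\<close>, and also
    \<open>e\<close> because \<open>D p e = -1\<close>. These six vectors are close to the standard
    basis, so it vanishes identically.\<close>
  have D_prop: "r' p h + r' p e * D p h = 0" if p: "p \<in> M" "p \<in> ball 0 d" for p h
  proof -
    have "\<phi> p = p" using p by (simp add: \<phi>_def Meq G_def)
    have Dpe: "D p e = -1" using De[of p] good[OF p(2)] \<open>\<phi> p = p\<close> by simp
    have "linear (r' p)" "linear (D p)"
      using der[of p] D[OF p(1)] good[OF p(2)] has_derivative_linear by blast+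
    hence lin: "linear (\<lambda>h. r' p h + r' p e * D p h)"
      by (intro linearI) (simp_all add: linear_add linear_scale algebra_simps)
    have vanish: "r' p (affine_field A p) + r' p e * D p (affine_field A p) = 0"
      if "A \<in> gens t1 t3 t4 m1" for A
      using tangent[of p A] DA[OF p(1) that] good[OF p(2)] that by auto
    have nearA: "\<exists>z. r' p z + r' p e * D p z = 0 \<and> norm (z - affine_field A 0) \<le> 1/7"
      if "A \<in> gens t1 t3 t4 m1" for A
      using vanish[OF that] good[OF p(2)] that by blast
    have "\<exists>z. r' p z + r' p e * D p z = 0 \<and> norm (z - b) \<le> 1/7" if "b \<in> Basis" for b
    proof (cases "b = e")
      case True
      thus ?thesis using Dpe by (intro exI[of _ e]) simp
    next
      case False
      with Basis_gens[OF that, of t1 t3 t4 m1]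
      obtain A where "A \<in> gens t1 t3 t4 m1" "affine_field A 0 = b" unfolding e_def by blast
      thus ?thesis using nearA by blast
    qed
    from linear_functional_zero_if_near_basis[OF lin _ this] show ?thesis by simp
  qed

  \<comment> \<open>By the chain rule the derivative of \<open>r\<close> after \<open>\<phi>\<close>
    is exactly the functional of \<open>D_prop\<close> at \<open>\<phi> q\<close>.\<close>
  have const: "r (\<phi> q) = 0" if q: "q \<in> ball 0 d1" for q
  proof -
    have "((\<lambda>q. r (\<phi> q)) has_derivative (\<lambda>h. 0)) (at q)" if "q \<in> ball 0 d1" for q
    proof -
      have b: "\<phi> q \<in> ball 0 d" using \<phi>ball[OF that] .
      hence u: "\<phi> q \<in> U" and n: "\<phi> q \<in> N" using good by auto
      have "(\<phi> has_derivative (\<lambda>h. h + D (\<phi> q) h *\<^sub>R e)) (at q)"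
        unfolding \<phi>_def[abs_def] using D\<phi>[OF u, unfolded \<phi>_def]
        by (auto intro!: derivative_eq_intros)
      hence "((\<lambda>q. r (\<phi> q)) has_derivative (\<lambda>h. r' (\<phi> q) (h + D (\<phi> q) h *\<^sub>R e))) (at q)"
        by (rule has_derivative_compose[where g = r]) (rule der[OF n])
      moreover have "r' (\<phi> q) (h + D (\<phi> q) h *\<^sub>R e) = 0" for h
      proof -
        have "linear (r' (\<phi> q))" using der[OF n] has_derivative_linear by blast
        thus ?thesis using D_prop[OF \<phi>M[OF u] b, of h]
          by (simp add: linear_add linear_scale mult.commute)
      qed
      ultimately show ?thesis by simp
    qed
    then obtain k where "\<And>q. q \<in> ball 0 d1 \<Longrightarrow> r (\<phi> q) = k"
      using has_derivative_zero_constant[of "ball 0 d1" "\<lambda>q. r (\<phi> q)"]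
      by (metis convex_ball has_derivative_at_withinI)
    from this[OF q] this[of 0] show ?thesis using d1 by (simp add: \<phi>0 r0)
  qed

  define V where "V = ball (0::complex^3) (min d d1)"
  have "p \<in> M \<longleftrightarrow> r p = 0" if "p \<in> V" for p
  proof
    assume "p \<in> M"
    hence "\<phi> p = p" by (simp add: \<phi>_def Meq G_def)
    thus "r p = 0" using const[of p] that by (simp add: V_def)
  next
    assume rp: "r p = 0"
    have p: "p \<in> ball 0 d" "p \<in> ball 0 d1" using that by (auto simp: V_def)
    have r\<phi>: "r (\<phi> p) = 0" using const[OF p(2)] .
    have seg: "p + s *\<^sub>R e \<in> ball 0 d" if "s \<in> closed_segment 0 (G p)" for s
    proof -
      obtain u where u: "0 \<le> u" "u \<le> 1" "s = u * G p"
        using \<open>s \<in> closed_segment 0 (G p)\<close> by (auto simp: closed_segment_def)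
      have "p + s *\<^sub>R e = (1 - u) *\<^sub>R p + u *\<^sub>R \<phi> p"
        by (simp add: \<phi>_def u algebra_simps)
      thus ?thesis
        using convexD_alt[OF convex_ball p(1) \<phi>ball[OF p(2)] u(1,2)] by simp
    qed
    have deriv: "((\<lambda>s. r (p + s *\<^sub>R e)) has_derivative (\<lambda>h. h * r' (p + s *\<^sub>R e) e)) (at s)"
      if "s \<in> closed_segment 0 (G p)" for s
    proof -
      have n: "p + s *\<^sub>R e \<in> N" using good[OF seg[OF that]] by simp
      have "((\<lambda>s. r (p + s *\<^sub>R e)) has_derivative (\<lambda>h. r' (p + s *\<^sub>R e) (h *\<^sub>R e))) (at s)"
        by (rule has_derivative_compose[where g = r and f = "\<lambda>s. p + s *\<^sub>R e"])
           (auto intro!: derivative_eq_intros der[OF n])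
      thus ?thesis
        using has_derivative_linear[OF der[OF n]] by (simp add: linear_scale)
    qed
    \<comment> \<open>Otherwise \<open>r\<close> vanishes at both ends of the vertical segment from
      \<open>p\<close> to \<open>\<phi> p\<close>, and the mean value theorem gives a zero of the
      \<open>v\<close>-derivative in between.\<close>
    have "G p = 0"
    proof (rule ccontr)
      assume nz: "G p \<noteq> 0"
      define a b where "a = min 0 (G p)" and "b = max 0 (G p)"
      have ab: "a < b" "{a..b} = closed_segment 0 (G p)"
        using nz by (auto simp: a_def b_def closed_segment_eq_real_ivl)
      have eq: "r (p + a *\<^sub>R e) = r (p + b *\<^sub>R e)"
        using rp r\<phi> by (auto simp: a_def b_def min_def max_def \<phi>_def)
      have "\<exists>x>a. x < b \<and> r (p + b *\<^sub>R e) - r (p + a *\<^sub>R e) = (b - a) * r' (p + x *\<^sub>R e) e"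
      proof (rule mvt[OF ab(1), of "\<lambda>s. r (p + s *\<^sub>R e)" "\<lambda>x h. h * r' (p + x *\<^sub>R e) e", simplified])
        show "continuous_on {a..b} (\<lambda>s. r (p + s *\<^sub>R e))"
          using deriv unfolding ab
          by (intro continuous_at_imp_continuous_on ballI has_derivative_continuous)
        show "((\<lambda>s. r (p + s *\<^sub>R e)) has_derivative (\<lambda>h. h * r' (p + x *\<^sub>R e) e)) (at x)"
          if "a < x" "x < b" for x
          using deriv[of x] that ab(2) by (metis atLeastAtMost_iff less_imp_le)
      qed blast
      then obtain x where x: "a < x" "x < b" "r' (p + x *\<^sub>R e) e = 0"
        using eq ab(1) by auto
      hence "x \<in> closed_segment 0 (G p)" using ab(2) by (metis atLeastAtMost_iff less_imp_le)
      from good[OF seg[OF this]] x show False by simp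
    qed
    hence "\<phi> p = p" by (simp add: \<phi>_def)
    thus "p \<in> M" using \<phi>M[of p] good[OF p(1)] by simp
  qed
  moreover have "V \<subseteq> N" using good by (auto simp: V_def)
  moreover have "open V" "0 \<in> V" using d d1 by (auto simp: V_def)
  ultimately show ?thesis by blast
qed

section \<open>From a first integral to an affine equivalence\<close>

text \<open>The function \<open>\<rho>\<close>, defining \<open>S\<close> in \<open>W\<close>, is
  pulled back by the affine map to a first integral near \<open>0\<close>; its zero set is
  \<open>M\<close> there. The affine map is a homeomorphism, so it carries this neighbourhood to an
  open set.\<close>

lemma aff_equivI:
  fixes L :: "complex^3^3" and b :: "complex^3" and \<rho> :: "complex^3 \<Rightarrow> real"
  assumes M: "integral_variety (g_alg t1 t3 t4 m1) M"
    and L: "invertible L"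
    and W: "open W" "b \<in> W"
    and der: "\<And>q. q \<in> W \<Longrightarrow> (\<rho> has_derivative \<rho>' q) (at q)"
    and tangent: "\<And>p A. L *v p + b \<in> W \<Longrightarrow> A \<in> gens t1 t3 t4 m1 \<Longrightarrow>
        \<rho>' (L *v p + b) (L *v affine_field A p) = 0"
    and cont: "isCont (\<lambda>q. \<rho>' q (L *v axis 3 \<i>)) b"
    and nz: "\<rho>' b (L *v axis 3 \<i>) \<noteq> 0"
    and b0: "\<rho> b = 0"
    and S: "\<And>q. q \<in> W \<Longrightarrow> q \<in> S \<longleftrightarrow> \<rho> q = 0"
  shows "aff_equiv M S"
proof -
  define T where "T p = L *v p + b" for p
  have lin: "bounded_linear ((*v) L)"
    by (rule linear_conv_bounded_linear[THEN iffD1])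
       (auto intro!: linearI simp: matrix_vector_right_distrib vec_eq_iff
          matrix_vector_mult_def scaleR_sum_right)
  have dT: "(T has_derivative (\<lambda>h. L *v h)) (at p)" for p
    unfolding T_def[abs_def] using bounded_linear_imp_has_derivative[OF lin]
    by (auto intro!: derivative_eq_intros)
  have contT: "continuous_on UNIV T"
    using dT by (meson continuous_at_imp_continuous_on has_derivative_continuous)
  obtain L' where L': "L ** L' = mat 1" "L' ** L = mat 1" using L by (auto simp: invertible_def)
  define T' where "T' q = L' *v (q - b)" for q
  have TT': "T (T' q) = q" and T'T: "T' (T p) = p" for p q
    by (simp_all add: T_def T'_def matrix_vector_mul_assoc L')
  have lin': "bounded_linear ((*v) L')"
    by (rule linear_conv_bounded_linear[THEN iffD1])
       (auto intro!: linearI simp: matrix_vector_right_distrib vec_eq_iff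
          matrix_vector_mult_def scaleR_sum_right)
  have contT': "continuous_on UNIV T'"
    unfolding T'_def[abs_def] by (intro bounded_linear.continuous_on[OF lin'] continuous_intros)
  have "\<exists>V. open V \<and> 0 \<in> V \<and> V \<subseteq> T -` W \<and> M \<inter> V = {p \<in> V. \<rho> (T p) = 0}"
  proof (rule first_integral_zero_set[OF M, where r' = "\<lambda>p h. \<rho>' (T p) (L *v h)"])
    show "open (T -` W)" using contT W(1) by (metis open_vimage)
    show "((\<lambda>p. \<rho> (T p)) has_derivative (\<lambda>h. \<rho>' (T p) (L *v h))) (at p)" if "p \<in> T -` W" for p
      using that by (intro has_derivative_compose[where g = \<rho>, OF dT] der) auto
    have "isCont T 0" using contT by (simp add: continuous_on_eq_continuous_at)
    thus "isCont (\<lambda>p. \<rho>' (T p) (L *v axis 3 \<i>)) 0"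
      by (rule isCont_o2) (use cont in \<open>simp add: T_def\<close>)
  qed (use W tangent nz b0 in \<open>auto simp: T_def\<close>)
  then obtain V where V: "open V" "0 \<in> V" "V \<subseteq> T -` W" "M \<inter> V = {p \<in> V. \<rho> (T p) = 0}" by blast
  have img: "T ` V = T' -` V"
  proof (intro equalityI subsetI)
    fix q assume "q \<in> T' -` V"
    thus "q \<in> T ` V" by (intro image_eqI[of _ _ "T' q"]) (auto simp: TT')
  qed (auto simp: T'T)
  have "T ` (M \<inter> V) = S \<inter> T ` V"
    unfolding V(4) using S V(3) by blast
  moreover have "open (T ` V)" unfolding img using contT' V(1) by (metis open_vimage)
  ultimately show ?thesis
    unfolding aff_equiv_def using L V(1,2) unfolding T_def by metis
qed

section \<open>Coordinates of matrices, generators and derivatives\<close>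

lemma matrix_vector_mult_3:
  "(vector [vector [a1, a2, a3], vector [b1, b2, b3], vector [c1, c2, c3]] :: 'a::semiring_1^3^3) *v p =
    vector [a1 * p$1 + a2 * p$2 + a3 * p$3, b1 * p$1 + b2 * p$2 + b3 * p$3, c1 * p$1 + c2 * p$2 + c3 * p$3]"
  by (simp add: vec_eq_iff forall_3 matrix_vector_mult_def sum_3)

lemma gensE:
  assumes "A \<in> gens t1 t3 t4 m1"
  obtains "A = E1 t1 t3 t4 m1" | "A = E2 t1 t3 t4 m1" | "A = E3 t1 t3 t4 m1"
    | "A = E4 t1 t3 t4 m1" | "A = E5 t1 t3 t4 m1"
  using assms by blast

lemmas E_defs = E1_def E2_def E3_def E4_def E5_def mat_of_rows_def Let_def

lemma bounded_linear_Re_nth: "bounded_linear (\<lambda>q::complex^3. Re (q $ i))"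
  by (rule bounded_linear_compose[OF bounded_linear_Re bounded_linear_vec_nth])

lemma bounded_linear_Im_nth: "bounded_linear (\<lambda>q::complex^3. Im (q $ i))"
  by (rule bounded_linear_compose[OF bounded_linear_Im bounded_linear_vec_nth])

lemmas has_derivative_Re_nth [derivative_intros] = bounded_linear.has_derivative[OF bounded_linear_Re_nth]
lemmas has_derivative_Im_nth [derivative_intros] = bounded_linear.has_derivative[OF bounded_linear_Im_nth]

section \<open>The case \<open>t3 = t4 = 0\<close>: models 1 and 2\<close>

lemma aff_equiv_model1:
  fixes m1 t1 :: real
  assumes M: "integral_variety (g_alg t1 0 0 m1) M" and 0: "t1 + 2 * m1 = 0"
  shows "aff_equiv M model1"
proof -
  \<comment> \<open>The first row is \<open>z = z1 - (i m1/2) w\<close>. For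
    \<open>t1 + 2 * m1 = 0\<close> the field \<open>E1\<close> becomes
    \<open>z' = 1, w' = 4 i z\<close>, which preserves \<open>v - 2 x^2\<close>.\<close>
  define L where "L = (vector [vector [1, 0, - (\<i>/2) * m1], vector [0, 1, 0], vector [0, 0, 1]] :: complex^3^3)"
  define \<rho> where "\<rho> q = Im (q$3) - 2 * (Re (q$1))\<^sup>2 - ((Re (q$2))\<^sup>2 + (Im (q$2))\<^sup>2)" for q :: "complex^3"
  define \<rho>' where "\<rho>' q h = Im (h$3) - 4 * Re (q$1) * Re (h$1) - 2 * (Re (q$2) * Re (h$2) + Im (q$2) * Im (h$2))"
    for q h :: "complex^3"
  have t1: "t1 = - 2 * m1" using 0 by simp
  show ?thesis
  proof (rule aff_equivI[OF M, where L = L and b = 0 and W = UNIV and \<rho> = \<rho> and \<rho>' = \<rho>'])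
    show "invertible L"
      by (simp add: invertible_det_nz det_3 L_def)
    show "(\<rho> has_derivative \<rho>' q) (at q)" for q
      unfolding \<rho>_def[abs_def] \<rho>'_def[abs_def] by (auto intro!: derivative_eq_intros simp: algebra_simps)
    show "\<rho>' (L *v p + 0) (L *v affine_field A p) = 0" if "A \<in> gens t1 0 0 m1" for p A
      using that
      by (cases rule: gensE)
         (simp_all add: \<rho>'_def L_def matrix_vector_mult_3 E_defs t1 algebra_simps)
    show "isCont (\<lambda>q. \<rho>' q (L *v axis 3 \<i>)) 0"
      unfolding \<rho>'_def by (intro continuous_intros linear_continuous_at
          bounded_linear_Re_nth bounded_linear_Im_nth)
    show "\<rho>' 0 (L *v axis 3 \<i>) \<noteq> 0"
      by (simp add: \<rho>'_def L_def matrix_vector_mult_3 axis_def)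
  qed (auto simp: \<rho>_def model1_def cmod_power2)
qed

lemma aff_equiv_model2:
  fixes m1 t1 :: real
  assumes M: "integral_variety (g_alg t1 0 0 m1) M" and l: "t1 + 2 * m1 \<noteq> 0"
  shows "aff_equiv M model2"
proof -
  define l where "l = t1 + 2 * m1"
  \<comment> \<open>In terms of \<open>z = z1 - (i m1/2) w\<close> the rows are \<open>l z\<close>,
    \<open>(l/2) z2\<close> and \<open>- i l z + (l^2/4) w\<close>. In the last one the
    \<open>z\<close> terms cancel under \<open>E1\<close>, leaving the constant rate
    \<open>- i l\<close>; the factor \<open>l/2\<close> matches \<open>|z2|^2\<close> to
    \<open>l^2/4\<close>.\<close>
  define L where "L = (vector [vector [complex_of_real l, 0, - (\<i>/2) * m1 * l], vector [0, l / 2, 0],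
      vector [- \<i> * l, 0, l\<^sup>2 / 4 - m1 * l / 2]] :: complex^3^3)"
  define \<rho> where "\<rho> q = Im (q$3) + ln (1 + Re (q$1)) - ((Re (q$2))\<^sup>2 + (Im (q$2))\<^sup>2)" for q :: "complex^3"
  define \<rho>' where "\<rho>' q h = Im (h$3) + Re (h$1) / (1 + Re (q$1)) - 2 * (Re (q$2) * Re (h$2) + Im (q$2) * Im (h$2))"
    for q h :: "complex^3"
  define W where "W = {q::complex^3. 1 + Re (q$1) > 0}"
  have t1: "t1 = l - 2 * m1" and l0: "l \<noteq> 0" using l by (auto simp: l_def)
  show ?thesis
  proof (rule aff_equivI[OF M, where L = L and b = 0 and W = W and \<rho> = \<rho> and \<rho>' = \<rho>'])
    have "det L = l ^ 4 / 8"
      by (simp add: det_3 L_def algebra_simps power2_eq_square power4_eq_xxxx)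
    hence "det L \<noteq> 0" using l0 by (simp only:) simp
    thus "invertible L" by (simp add: invertible_det_nz)
    show "open W" unfolding W_def by (intro open_Collect_less continuous_intros)
    show "(\<rho> has_derivative \<rho>' q) (at q)" if "q \<in> W" for q
      unfolding \<rho>_def[abs_def] \<rho>'_def[abs_def] using that
      by (auto intro!: derivative_eq_intros simp: W_def algebra_simps divide_inverse)
    show "\<rho>' (L *v p + 0) (L *v affine_field A p) = 0" if "L *v p + 0 \<in> W" "A \<in> gens t1 0 0 m1" for p A
    proof -
      define x where "x = 1 + Re ((L *v p + 0) $ 1)"
      have x: "x > 0" "x = 1 + l * Re (p$1) + m1 * l * Im (p$3) / 2"
        using that(1) by (simp_all add: x_def W_def L_def matrix_vector_mult_3)
      from that(2) show ?thesis
      proof (cases rule: gensE)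
        case 1
        \<comment> \<open>The logarithm of \<open>x\<close> grows at rate \<open>l\<close> along
          \<open>E1\<close>, which cancels the rate \<open>- l\<close> of the last imaginary
          part.\<close>
        have "Re ((L *v affine_field A p) $ 1) = l * x" "Im ((L *v affine_field A p) $ 3) = - l"
          "(L *v affine_field A p) $ 2 = 0"
          by (simp_all add: 1 x(2) L_def matrix_vector_mult_3 E_defs t1 field_simps power2_eq_square)
        thus ?thesis unfolding \<rho>'_def x_def[symmetric] using x(1) by simp
      qed (simp_all add: \<rho>'_def L_def matrix_vector_mult_3 E_defs field_simps power2_eq_square)
    qed
    show "isCont (\<lambda>q. \<rho>' q (L *v axis 3 \<i>)) 0"
      unfolding \<rho>'_def by (intro continuous_intros linear_continuous_at
          bounded_linear_Re_nth bounded_linear_Im_nth) simp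
    show "\<rho>' 0 (L *v axis 3 \<i>) \<noteq> 0"
      using l0 by (simp add: \<rho>'_def L_def matrix_vector_mult_3 axis_def power2_eq_square)
  qed (auto simp: \<rho>_def model2_def W_def cmod_power2)
qed

section \<open>The case of nonzero \<open>t3 + i t4\<close>: model 3\<close>

text \<open>The linear parts of the eigenforms of \<open>E1\<close>: \<open>1 + X_form\<close> belongs to the eigenvalue \<open>0\<close> and
  \<open>1 + Z_form l\<close> to the root \<open>l\<close>.\<close>

definition X_form :: "real \<Rightarrow> real \<Rightarrow> complex^3 \<Rightarrow> complex" where
  "X_form t3 t4 p = - (t3 + \<i> * t4) * p$2 - (\<i>/2) * (t3\<^sup>2 + t4\<^sup>2) * p$3"

definition Z_form :: "real \<Rightarrow> real \<Rightarrow> real \<Rightarrow> real \<Rightarrow> complex^3 \<Rightarrow> complex" where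
  "Z_form t3 t4 m1 l p = l * p$1 + (t3 + \<i> * t4) * p$2 - (\<i>/2) * (m1 * l + (t3\<^sup>2 + t4\<^sup>2)) * p$3"

lemma X_form_fields:
  "X_form t3 t4 (affine_field (E1 t1 t3 t4 m1) p) = 0"
  "X_form t3 t4 (affine_field (E2 t1 t3 t4 m1) p) = 0"
  "X_form t3 t4 (affine_field (E3 t1 t3 t4 m1) p) = - (t3 + \<i> * t4) * (1 + X_form t3 t4 p)"
  "X_form t3 t4 (affine_field (E4 t1 t3 t4 m1) p) = - \<i> * (t3 + \<i> * t4) * (1 + X_form t3 t4 p)"
  "X_form t3 t4 (affine_field (E5 t1 t3 t4 m1) p) = - (\<i>/2) * (t3\<^sup>2 + t4\<^sup>2) * (1 + X_form t3 t4 p)"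
  unfolding X_form_def
  by (simp_all add: E_defs field_simps power2_eq_square)

text \<open>Write \<open>X = 1 + X_form\<close> and \<open>Z = 1 + Z_form l\<close>. Each of
  \<open>E2\<close> to \<open>E5\<close> acts by \<open>X' = a X\<close>,
  \<open>Z' = - cnj a Z + i c X\<close> with \<open>c\<close> real, which leaves
  \<open>Re (cnj X * Z)\<close> invariant. \<open>E1\<close> fixes \<open>X\<close> and multiplies
  \<open>Z\<close> by \<open>l\<close>, so it scales this product by \<open>l\<close>.\<close>

lemma Z_form_fields:
  "l\<^sup>2 = (t1 + 2 * m1) * l + 4 * (t3\<^sup>2 + t4\<^sup>2) \<Longrightarrow>
    Z_form t3 t4 m1 l (affine_field (E1 t1 t3 t4 m1) p) = l * (1 + Z_form t3 t4 m1 l p)" (is "?h \<Longrightarrow> ?goal")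
  "Z_form t3 t4 m1 l (affine_field (E2 t1 t3 t4 m1) p) = \<i> * l * (1 + X_form t3 t4 p)"
  "Z_form t3 t4 m1 l (affine_field (E3 t1 t3 t4 m1) p) =
    (t3 - \<i> * t4) * (1 + Z_form t3 t4 m1 l p) + 2 * \<i> * t4 * (1 + X_form t3 t4 p)"
  "Z_form t3 t4 m1 l (affine_field (E4 t1 t3 t4 m1) p) =
    - \<i> * (t3 - \<i> * t4) * (1 + Z_form t3 t4 m1 l p) + 2 * \<i> * t3 * (1 + X_form t3 t4 p)"
  "Z_form t3 t4 m1 l (affine_field (E5 t1 t3 t4 m1) p) =
    - (\<i>/2) * (t3\<^sup>2 + t4\<^sup>2) * (1 + Z_form t3 t4 m1 l p) - (\<i>/2) * m1 * l * (1 + X_form t3 t4 p)"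
proof -
  assume ?h
  hence "l * l = (t1 + 2 * m1) * l + 4 * (t3 * t3 + t4 * t4)" by (simp only: power2_eq_square)
  hence h: "complex_of_real (l * l - ((t1 + 2 * m1) * l + 4 * (t3 * t3 + t4 * t4))) = 0"
    by simp
  \<comment> \<open>The two sides differ by a multiple of the quadratic polynomial of which
    \<open>l\<close> is a root.\<close>
  have "l * (1 + Z_form t3 t4 m1 l p) - Z_form t3 t4 m1 l (affine_field (E1 t1 t3 t4 m1) p) =
      complex_of_real (l * l - ((t1 + 2 * m1) * l + 4 * (t3 * t3 + t4 * t4))) * (p$1 - (\<i>/2) * m1 * p$3)"
    unfolding Z_form_def
    by (simp add: E_defs algebra_simps power2_eq_square)
  thus ?goal unfolding h by (simp only: mult_zero_left right_minus_eq)
qed (simp_all add: Z_form_def X_form_def E_defs field_simps power2_eq_square)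


lemma aff_equiv_model3:
  fixes t1 t3 t4 m1 :: real
  assumes M: "integral_variety (g_alg t1 t3 t4 m1) M" and n: "t3\<^sup>2 + t4\<^sup>2 > 0"
  shows "\<exists>\<alpha><0. aff_equiv M (model3 \<alpha>)"
proof -
  \<comment> \<open>\<open>d\<close> is the square root of the discriminant of the quadratic
    equation for \<open>l\<close>; \<open>d > |t1 + 2 m1|\<close> puts its roots on both sides of
    \<open>0\<close>.\<close>
  define d where "d = sqrt ((t1 + 2 * m1)\<^sup>2 + 16 * (t3\<^sup>2 + t4\<^sup>2))"
  define lp where "lp = (t1 + 2 * m1 + d) / 2"
  define lm where "lm = (t1 + 2 * m1 - d) / 2"
  have d2: "d\<^sup>2 = (t1 + 2 * m1)\<^sup>2 + 16 * (t3\<^sup>2 + t4\<^sup>2)" unfolding d_def using n by simp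
  have "\<bar>t1 + 2 * m1\<bar> < d" unfolding d_def using n by (intro real_less_rsqrt) simp
  hence lp0: "lp > 0" and lm0: "lm < 0" by (auto simp: lp_def lm_def)
  have qp: "lp\<^sup>2 = (t1 + 2 * m1) * lp + 4 * (t3\<^sup>2 + t4\<^sup>2)"
   and qm: "lm\<^sup>2 = (t1 + 2 * m1) * lm + 4 * (t3\<^sup>2 + t4\<^sup>2)"
    using d2 unfolding lp_def lm_def by (simp_all add: power2_eq_square field_simps)
  define \<alpha> where "\<alpha> = lm / lp"
  have \<alpha>: "\<alpha> < 0" "\<alpha> * lp = lm" using lp0 lm0 by (auto simp: \<alpha>_def field_simps)
  define L where "L = (vector [
      vector [0, - (t3 + \<i> * t4), - (\<i>/2) * (t3\<^sup>2 + t4\<^sup>2)],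
      vector [lp, t3 + \<i> * t4, - (\<i>/2) * (m1 * lp + (t3\<^sup>2 + t4\<^sup>2))],
      vector [lm, t3 + \<i> * t4, - (\<i>/2) * (m1 * lm + (t3\<^sup>2 + t4\<^sup>2))]] :: complex^3^3)"
  define b where "b = (vector [1, 1, 1] :: complex^3)"
  have L_nth: "(L *v p) $ 1 = X_form t3 t4 p" "(L *v p) $ 2 = Z_form t3 t4 m1 lp p"
      "(L *v p) $ 3 = Z_form t3 t4 m1 lm p" for p
    by (simp_all add: L_def matrix_vector_mult_3 X_form_def Z_form_def)
  have b_nth: "b $ 1 = 1" "b $ 2 = 1" "b $ 3 = 1" by (simp_all add: b_def)
  define A B where "A q = Re (q$1) * Re (q$3) + Im (q$1) * Im (q$3)"
    and "B q = Re (q$1) * Re (q$2) + Im (q$1) * Im (q$2)" for q :: "complex^3"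
  define A' B' where
    "A' q h = Re (q$1) * Re (h$3) + Re (h$1) * Re (q$3) + (Im (q$1) * Im (h$3) + Im (h$1) * Im (q$3))"
    and "B' q h = Re (q$1) * Re (h$2) + Re (h$1) * Re (q$2) + (Im (q$1) * Im (h$2) + Im (h$1) * Im (q$2))"
    for q h :: "complex^3"
  note AB_defs = A_def B_def A'_def B'_def
  \<comment> \<open>\<open>E1\<close> scales \<open>A\<close> at rate \<open>lm\<close> and
    \<open>B\<close> at rate \<open>lp\<close>, so \<open>ln A\<close> minus \<open>\<alpha>\<close>
    times \<open>ln B\<close> is invariant exactly when \<open>\<alpha> * lp = lm\<close>.\<close>
  define \<rho> where "\<rho> q = ln (A q) - \<alpha> * ln (B q)" for q
  define \<rho>' where "\<rho>' q h = A' q h / A q - \<alpha> * (B' q h / B q)" for q h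
  define W where "W = {q. A q > 0} \<inter> {q. B q > 0}"
  have contA: "continuous_on UNIV A" "continuous_on UNIV B"
    unfolding A_def[abs_def] B_def[abs_def] by (intro continuous_intros)+
  have dA: "(A has_derivative A' q) (at q)" "(B has_derivative B' q) (at q)" for q
    unfolding AB_defs[abs_def] by (auto intro!: derivative_eq_intros)
  have "aff_equiv M (model3 \<alpha>)"
  proof (rule aff_equivI[OF M, where L = L and b = b and W = W and \<rho> = \<rho> and \<rho>' = \<rho>'])
    have "det L = \<i> * (t3 + \<i> * t4) * (t3\<^sup>2 + t4\<^sup>2) * (lm - lp)"
      by (simp add: det_3 L_def field_simps power2_eq_square)
    moreover have "complex_of_real t3 + \<i> * t4 \<noteq> 0" using n by (auto simp: complex_eq_iff)
    moreover have "(complex_of_real t3)\<^sup>2 + (complex_of_real t4)\<^sup>2 \<noteq> 0"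
      using n by (metis of_real_add of_real_eq_0_iff of_real_power less_irrefl)
    moreover have "complex_of_real lm - lp \<noteq> 0"
      using lp0 lm0 by (metis of_real_diff of_real_eq_0_iff eq_iff_diff_eq_0 less_asym)
    ultimately show "invertible L" by (simp add: invertible_det_nz)
    show "open W" unfolding W_def
      using contA by (intro open_Int open_Collect_less continuous_intros)
    show "b \<in> W" by (simp add: W_def AB_defs b_nth)
    show "(\<rho> has_derivative \<rho>' q) (at q)" if "q \<in> W" for q
      unfolding \<rho>_def[abs_def] \<rho>'_def[abs_def] using that
      by (auto intro!: derivative_eq_intros dA simp: W_def divide_inverse)
    show "\<rho>' (L *v p + b) (L *v affine_field E p) = 0"
      if "L *v p + b \<in> W" "E \<in> gens t1 t3 t4 m1" for p E
    proof -
      define q where "q = L *v p + b"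
      have q: "1 + X_form t3 t4 p = q $ 1" "1 + Z_form t3 t4 m1 lp p = q $ 2"
          "1 + Z_form t3 t4 m1 lm p = q $ 3"
        by (simp_all add: q_def L_nth b_nth)
      have pos: "A q > 0" "B q > 0" using that(1) by (auto simp: q_def W_def)
      note forms = L_nth X_form_fields Z_form_fields(2-) q
      have invariant: "A' q (L *v affine_field E p) = 0 \<and> B' q (L *v affine_field E p) = 0"
        if "E \<in> {E2 t1 t3 t4 m1, E3 t1 t3 t4 m1, E4 t1 t3 t4 m1, E5 t1 t3 t4 m1}"
        using that by (elim insertE)
          (simp_all add: AB_defs forms algebra_simps power2_eq_square)
      have scaling: "A' q (L *v affine_field E p) = lm * A q" "B' q (L *v affine_field E p) = lp * B q"
        if "E = E1 t1 t3 t4 m1"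
        by (simp_all add: that AB_defs forms Z_form_fields(1)[OF qp] Z_form_fields(1)[OF qm] algebra_simps)
      have "\<rho>' q (L *v affine_field E p) = 0"
        using invariant scaling pos \<alpha>(2) that(2) by (auto simp: \<rho>'_def)
      thus ?thesis by (simp add: q_def)
    qed
    show "isCont (\<lambda>q. \<rho>' q (L *v axis 3 \<i>)) b"
      unfolding \<rho>'_def AB_defs by (intro continuous_intros linear_continuous_at
          bounded_linear_Re_nth bounded_linear_Im_nth) (simp_all add: b_nth)
    \<comment> \<open>The terms with \<open>m1\<close> cancel because
      \<open>\<alpha> * lp = lm\<close>.\<close>
    have "\<rho>' b (L *v axis 3 \<i>) = (1 - \<alpha>) * (t3\<^sup>2 + t4\<^sup>2)"
      using \<alpha>(2)
      by (simp add: \<rho>'_def AB_defs b_nth L_nth X_form_def Z_form_def axis_def field_simps power2_eq_square)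
    thus "\<rho>' b (L *v axis 3 \<i>) \<noteq> 0" using n \<alpha>(1) by auto
    show "q \<in> model3 \<alpha> \<longleftrightarrow> \<rho> q = 0" if "q \<in> W" for q
    proof -
      have pos: "A q > 0" "B q > 0" using that by (auto simp: W_def)
      have "\<rho> q = 0 \<longleftrightarrow> ln (A q) = ln (B q powr \<alpha>)"
        using pos by (simp add: \<rho>_def ln_powr)
      also have "\<dots> \<longleftrightarrow> A q = B q powr \<alpha>" using pos by (intro ln_inj_iff) simp_all
      finally show ?thesis using pos by (simp add: model3_def AB_defs algebra_simps)
    qed
  qed (simp add: \<rho>_def AB_defs b_nth)
  with \<alpha>(1) show ?thesis by blast
qed

theorem theorem4p7:
  fixes t1 t3 t4 m1 :: real and M :: "(complex^3) set"
  assumes "integral_variety (g_alg t1 t3 t4 m1) M"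
  shows "aff_equiv M model1 \<or> aff_equiv M model2 \<or> (\<exists>\<alpha><0. aff_equiv M (model3 \<alpha>))"
proof (cases "t3 = 0 \<and> t4 = 0")
  case True
  thus ?thesis using assms aff_equiv_model1 aff_equiv_model2 by blast
next
  case False
  hence "t3\<^sup>2 + t4\<^sup>2 > 0" by (simp add: sum_power2_gt_zero_iff)
  thus ?thesis using assms aff_equiv_model3 by blast
qed

end
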